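(* Let $\mathbf R=(R,\oplus,\cdot,0,1)$ be a ring-like structure of events (RLSE) which admits a full set $S$ of states. For $x\in R$ define $q_x:S\to[0,1]$ by $q_x(m):=m(x)$. Then $\mathbf R$ is order-isomorphic (via $x\mapsto q_x$) to the set $P:=\{q_x\mid x\in R\}$ of $S$-probabilities ordered pointwise, and $P$ is a lattice-ordered algebra of $S$-probabilities.
   Context: A ring-like structure of events (RLSE) is an algebra $(R,\oplus,\cdot,0,1)$ of type $(2,2,0,0)$ such that $(R,\cdot,1)$ is an idempotent commutative monoid with zero element $0$ (i.e. $x0=0$), satisfying (R1) $x\oplus y= y\oplus x$; (R2) $(xy\oplus1)(x\oplus1)\oplus1= x$; (R3) $((xy\oplus1)x\oplus1)x= xy$; (R4) $xy\oplus(x\oplus1)=(xy\oplus1)x\oplus1$. It is partially ordered by $x\le y$ iff $xy=x$, and $x\perp y$ means $x\le x\oplus 1$ replaced by $x\le y\oplus1$. A state on $\mathbf R$ is a map $m:R\to[0,1]$ with $m(1)=1$ and $m(x\oplus y)=m(x)+m(y)$ whenever $x\perp y$. A set $S$ of states is full if for all $x,y\in R$: $x\le y$ iff $m(x)\le m(y)$ for all $m\in S$. An $S$-probability is a function $S\to[0,1]$; with $p':=1-p$ and $p\perp q$ meaning $p\le q'$ pointwise, an algebra of $S$-probabilities is a set $P$ of $S$-probabilities containing the constants $0,1$, closed under $p\mapsto p'$, and such that $p+q+r\in P$ whenever $p,q,r\in P$ are pairwise orthogonal; it is lattice-ordered if it is a lattice under the pointwise order. *)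

theory Defs
  imports Complex_Main "HOL-Library.FuncSet" "HOL-Algebra.Ring" "HOL-Algebra.Lattice"
begin

(* The record type ring only supplies the signature (2,2,0,0); no ring axiom is assumed, and
   \<oplus> need not be associative. *)
locale rlse = comm_monoid R for R (structure) +
  assumes add_closed: "\<lbrakk>x \<in> carrier R; y \<in> carrier R\<rbrakk> \<Longrightarrow> x \<oplus> y \<in> carrier R"
    and zero_closed: "\<zero> \<in> carrier R"
    and mult_idem: "x \<in> carrier R \<Longrightarrow> x \<otimes> x = x"
    and mult_zero: "x \<in> carrier R \<Longrightarrow> x \<otimes> \<zero> = \<zero>"
    and R1: "\<lbrakk>x \<in> carrier R; y \<in> carrier R\<rbrakk> \<Longrightarrow> x \<oplus> y = y \<oplus> x"
    and R2: "\<lbrakk>x \<in> carrier R; y \<in> carrier R\<rbrakk> \<Longrightarrow>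
      (x \<otimes> y \<oplus> \<one>) \<otimes> (x \<oplus> \<one>) \<oplus> \<one> = x"
    and R3: "\<lbrakk>x \<in> carrier R; y \<in> carrier R\<rbrakk> \<Longrightarrow>
      ((x \<otimes> y \<oplus> \<one>) \<otimes> x \<oplus> \<one>) \<otimes> x = x \<otimes> y"
    and R4: "\<lbrakk>x \<in> carrier R; y \<in> carrier R\<rbrakk> \<Longrightarrow>
      x \<otimes> y \<oplus> (x \<oplus> \<one>) = (x \<otimes> y \<oplus> \<one>) \<otimes> x \<oplus> \<one>"

definition rlse_order :: "('a, 'b) ring_scheme \<Rightarrow> 'a gorder"
  where "rlse_order R =
    \<lparr>carrier = carrier R, eq = (=), le = (\<lambda>x y. x \<otimes>\<^bsub>R\<^esub> y = x)\<rparr>"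

definition rlse_orth :: "('a, 'b) ring_scheme \<Rightarrow> 'a \<Rightarrow> 'a \<Rightarrow> bool"
  where "rlse_orth R x y \<longleftrightarrow> x \<sqsubseteq>\<^bsub>rlse_order R\<^esub> (y \<oplus>\<^bsub>R\<^esub> \<one>\<^bsub>R\<^esub>)"

(* Maps on a carrier set are extensional functions, so that equality of maps is HOL equality. *)
definition rlse_state :: "('a, 'b) ring_scheme \<Rightarrow> ('a \<Rightarrow> real) \<Rightarrow> bool"
  where "rlse_state R m \<longleftrightarrow>
    m \<in> carrier R \<rightarrow>\<^sub>E {0..1} \<and> m \<one>\<^bsub>R\<^esub> = 1 \<and>
    (\<forall>x\<in>carrier R. \<forall>y\<in>carrier R. rlse_orth R x y \<longrightarrow> m (x \<oplus>\<^bsub>R\<^esub> y) = m x + m y)"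

definition full_states :: "('a, 'b) ring_scheme \<Rightarrow> ('a \<Rightarrow> real) set \<Rightarrow> bool"
  where "full_states R S \<longleftrightarrow>
    (\<forall>m\<in>S. rlse_state R m) \<and>
    (\<forall>x\<in>carrier R. \<forall>y\<in>carrier R.
      x \<sqsubseteq>\<^bsub>rlse_order R\<^esub> y \<longleftrightarrow> (\<forall>m\<in>S. m x \<le> m y))"

definition S_probs :: "'s set \<Rightarrow> ('s \<Rightarrow> real) set"
  where "S_probs S = S \<rightarrow>\<^sub>E {0..1}"

definition prob_compl :: "'s set \<Rightarrow> ('s \<Rightarrow> real) \<Rightarrow> 's \<Rightarrow> real"
  where "prob_compl S p = (\<lambda>s\<in>S. 1 - p s)"

definition prob_le :: "'s set \<Rightarrow> ('s \<Rightarrow> real) \<Rightarrow> ('s \<Rightarrow> real) \<Rightarrow> bool"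
  where "prob_le S p q \<longleftrightarrow> (\<forall>s\<in>S. p s \<le> q s)"

definition prob_orth :: "'s set \<Rightarrow> ('s \<Rightarrow> real) \<Rightarrow> ('s \<Rightarrow> real) \<Rightarrow> bool"
  where "prob_orth S p q \<longleftrightarrow> prob_le S p (prob_compl S q)"

definition prob_order :: "'s set \<Rightarrow> ('s \<Rightarrow> real) set \<Rightarrow> ('s \<Rightarrow> real) gorder"
  where "prob_order S P = \<lparr>carrier = P, eq = (=), le = prob_le S\<rparr>"

definition algebra_of_S_probs :: "'s set \<Rightarrow> ('s \<Rightarrow> real) set \<Rightarrow> bool"
  where "algebra_of_S_probs S P \<longleftrightarrow>
    P \<subseteq> S_probs S \<and>
    (\<lambda>s\<in>S. 0) \<in> P \<and> (\<lambda>s\<in>S. 1) \<in> P \<and>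
    (\<forall>p\<in>P. prob_compl S p \<in> P) \<and>
    (\<forall>p\<in>P. \<forall>q\<in>P. \<forall>r\<in>P.
      prob_orth S p q \<and> prob_orth S q r \<and> prob_orth S p r \<longrightarrow>
      (\<lambda>s\<in>S. p s + q s + r s) \<in> P)"

definition lattice_ordered_algebra_of_S_probs :: "'s set \<Rightarrow> ('s \<Rightarrow> real) set \<Rightarrow> bool"
  where "lattice_ordered_algebra_of_S_probs S P \<longleftrightarrow>
    algebra_of_S_probs S P \<and> lattice (prob_order S P)"

definition order_isomorphism ::
    "('a, 'c) gorder_scheme \<Rightarrow> ('b, 'd) gorder_scheme \<Rightarrow> ('a \<Rightarrow> 'b) \<Rightarrow> bool"
  where "order_isomorphism L M h \<longleftrightarrow>
    partial_order L \<and> partial_order M \<and>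
    bij_betw h (carrier L) (carrier M) \<and> order_emb L M h"

definition eval_prob :: "('a \<Rightarrow> real) set \<Rightarrow> 'a \<Rightarrow> ('a \<Rightarrow> real) \<Rightarrow> real"
  where "eval_prob S x = (\<lambda>m\<in>S. m x)"

end

theory Submission
  imports Defs
begin

text \<open>
  Write $x'$ for $x \<oplus> 1$. The axioms make $x \<mapsto> x'$ an antitone involution with $x x' = 0$, so the
  order is a lattice with meet $x y$ and join $(x' y')'$. By (R4), $x \<oplus> y$ is the join of $x$ and $y$
  whenever $x \<perp> y$. Hence for pairwise orthogonal $x, y, z$ the element $x \<oplus> y$ is still orthogonal
  to $z$, and states are additive on such triples. Fullness turns pointwise orthogonality of the
  functions $q_x$ into orthogonality in the algebra of events.
\<close>

section \<open>The lattice structure of the algebra of events\<close>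

context rlse
begin

abbreviation compl :: "'a \<Rightarrow> 'a"
  where "compl x \<equiv> x \<oplus> \<one>"

lemma compl_closed: "x \<in> carrier R \<Longrightarrow> compl x \<in> carrier R"
  by (simp add: add_closed)

text \<open>With first argument \<one>, (R3) collapses to this involution law.\<close>

lemma compl_compl: "x \<in> carrier R \<Longrightarrow> compl (compl x) = x"
  using R3[of \<one> x] by (simp add: compl_closed)

lemma compl_one: "compl \<one> = \<zero>"
proof -
  \<comment> \<open>\<open>compl \<zero>\<close> is inserted in (R2) so that the inner complement
    turns it back into \<zero>, which then annihilates the product.\<close>
  have "compl (\<zero> \<otimes> compl \<one>) = \<one>"
    using R2[of \<one> "compl \<zero>"] by (simp add: compl_closed compl_compl zero_closed)
  then have "compl \<zero> = \<one>"
    using mult_zero[of "compl \<one>"] by (simp add: m_comm compl_closed zero_closed)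
  then show ?thesis
    using compl_compl[OF zero_closed] by simp
qed

lemma compl_zero: "compl \<zero> = \<one>"
  using compl_compl[OF one_closed] by (simp add: compl_one)

text \<open>Since the product of \<open>y\<close> and \<open>x\<close> is \<open>x\<close>, (R2)
  exhibits \<open>y\<close> as the complement of \<open>compl x \<otimes> compl y\<close>;
  complementing once more gives the claim.\<close>

lemma compl_antitone:
  assumes "x \<in> carrier R" "y \<in> carrier R" "x \<otimes> y = x"
  shows "compl y \<otimes> compl x = compl y"
proof -
  have "compl (compl x \<otimes> compl y) = y"
    using R2[of y x] assms by (simp add: m_comm)
  then have "compl x \<otimes> compl y = compl y"
    using assms by (metis compl_compl compl_closed m_closed)
  then show ?thesis
    using assms by (simp add: m_comm compl_closed)
qed

text \<open>Taking \<zero> as second argument in (R3) makes the innermost factor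
  \<open>compl \<zero> = \<one>\<close>.\<close>

lemma mult_compl: "x \<in> carrier R \<Longrightarrow> compl x \<otimes> x = \<zero>"
  using R3[of x \<zero>] by (simp add: mult_zero compl_zero zero_closed)

lemma add_compl:
  assumes "x \<in> carrier R"
  shows "x \<oplus> compl x = \<one>"
  \<comment> \<open>With second argument \<one>, the right-hand side of (R4) is the complement of
    \<open>compl x \<otimes> x = \<zero>\<close>.\<close>
  using R4[of x \<one>] assms by (simp add: mult_compl compl_zero)

lemma mult_le1: "\<lbrakk>x \<in> carrier R; y \<in> carrier R\<rbrakk> \<Longrightarrow> (x \<otimes> y) \<otimes> x = x \<otimes> y"
  by (simp add: m_comm[of "x \<otimes> y" x] mult_idem flip: m_assoc)

definition rlse_join :: "'a \<Rightarrow> 'a \<Rightarrow> 'a"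
  where "rlse_join x y = compl (compl x \<otimes> compl y)"

lemma rlse_join_closed: "\<lbrakk>x \<in> carrier R; y \<in> carrier R\<rbrakk> \<Longrightarrow> rlse_join x y \<in> carrier R"
  by (simp add: rlse_join_def compl_closed)

lemma rlse_join_comm: "\<lbrakk>x \<in> carrier R; y \<in> carrier R\<rbrakk> \<Longrightarrow> rlse_join x y = rlse_join y x"
  by (simp add: rlse_join_def compl_closed m_comm)

lemma rlse_join_upper:
  assumes "x \<in> carrier R" "y \<in> carrier R"
  shows "x \<otimes> rlse_join x y = x"
  using compl_antitone[of "compl x \<otimes> compl y" "compl x"] assms
  by (simp add: rlse_join_def mult_le1 compl_compl compl_closed)

text \<open>By antitonicity \<open>compl z\<close> lies below both \<open>compl x\<close> and
  \<open>compl y\<close>, hence below their product; complementing reverses this.\<close>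

lemma rlse_join_least:
  assumes "x \<in> carrier R" "y \<in> carrier R" "z \<in> carrier R" "x \<otimes> z = x" "y \<otimes> z = y"
  shows "rlse_join x y \<otimes> z = rlse_join x y"
proof -
  have "compl z \<otimes> (compl x \<otimes> compl y) = compl z"
    using assms compl_antitone by (metis m_assoc compl_closed)
  then show ?thesis
    using compl_antitone[of "compl z" "compl x \<otimes> compl y"] assms
    by (simp add: rlse_join_def compl_compl compl_closed)
qed

text \<open>In (R4) at \<open>compl y\<close> and \<open>x\<close>, orthogonality reduces the
  product of the two to \<open>x\<close>, and the involution law turns the left-hand side into
  \<open>x \<oplus> y\<close>.\<close>

lemma add_orthogonal:
  assumes "x \<in> carrier R" "y \<in> carrier R" "x \<otimes> compl y = x"
  shows "x \<oplus> y = rlse_join x y"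
  using R4[of "compl y" x] assms
  by (simp add: rlse_join_def compl_compl compl_closed m_comm)

lemma partial_order_rlse_order: "partial_order (rlse_order R)"
proof
  fix x y z
  assume "x \<sqsubseteq>\<^bsub>rlse_order R\<^esub> y" "y \<sqsubseteq>\<^bsub>rlse_order R\<^esub> z"
    and "x \<in> carrier (rlse_order R)" "y \<in> carrier (rlse_order R)" "z \<in> carrier (rlse_order R)"
  then show "x \<sqsubseteq>\<^bsub>rlse_order R\<^esub> z"
    unfolding rlse_order_def by simp (metis m_assoc)
qed (auto simp: rlse_order_def mult_idem m_comm)

lemma lattice_rlse_order: "lattice (rlse_order R)"
proof -
  interpret partial_order "rlse_order R"
    by (rule partial_order_rlse_order)
  show ?thesis
  proof
    fix x y
    assume "x \<in> carrier (rlse_order R)" "y \<in> carrier (rlse_order R)"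
    then have xy: "x \<in> carrier R" "y \<in> carrier R"
      by (simp_all add: rlse_order_def)
    have "y \<otimes> rlse_join x y = y"
      using xy rlse_join_upper[of y x] by (simp add: rlse_join_comm)
    then have "least (rlse_order R) (rlse_join x y) (Upper (rlse_order R) {x, y})"
      using xy
      by (auto simp: least_def Upper_def rlse_order_def rlse_join_closed rlse_join_upper
          rlse_join_least)
    then show "\<exists>s. least (rlse_order R) s (Upper (rlse_order R) {x, y})" ..
    have "x \<otimes> y \<otimes> y = x \<otimes> y"
      using xy by (simp add: m_assoc mult_idem)
    moreover have "z \<otimes> (x \<otimes> y) = z" if "z \<in> carrier R" "z \<otimes> x = z" "z \<otimes> y = z" for z
      using xy that by (metis m_assoc)
    ultimately have "greatest (rlse_order R) (x \<otimes> y) (Lower (rlse_order R) {x, y})"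
      using xy by (auto simp: greatest_def Lower_def rlse_order_def mult_le1)
    then show "\<exists>s. greatest (rlse_order R) s (Lower (rlse_order R) {x, y})" ..
  qed
qed

end

text \<open>Suprema and infima are determined by the order alone, so \<open>h\<close> carries them
  over. This moves the lattice structure from events to their evaluations.\<close>

lemma order_isomorphism_lattice:
  assumes iso: "order_isomorphism L M h"
    and L: "lattice L"
  shows "lattice M"
proof -
  interpret L: lattice L by (rule L)
  interpret M: partial_order M
    using iso by (simp add: order_isomorphism_def)
  have car: "carrier M = h ` carrier L"
    using iso by (simp add: order_isomorphism_def bij_betw_def)
  have le: "h x \<sqsubseteq>\<^bsub>M\<^esub> h y \<longleftrightarrow> x \<sqsubseteq>\<^bsub>L\<^esub> y" if "x \<in> carrier L" "y \<in> carrier L" for x y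
    using iso that by (simp add: order_isomorphism_def order_emb_def)
  show ?thesis
  proof
    fix p q
    assume "p \<in> carrier M" "q \<in> carrier M"
    then obtain x y where xy: "x \<in> carrier L" "y \<in> carrier L" "p = h x" "q = h y"
      by (auto simp: car)
    obtain s where "least L s (Upper L {x, y})"
      using L.sup_of_two_exists xy by blast
    then have "least M (h s) (Upper M {p, q})"
      using xy by (auto simp: least_def Upper_def car le)
    then show "\<exists>s. least M s (Upper M {p, q})" ..
    obtain i where "greatest L i (Lower L {x, y})"
      using L.inf_of_two_exists xy by blast
    then have "greatest M (h i) (Lower M {p, q})"
      using xy by (auto simp: greatest_def Lower_def car le)
    then show "\<exists>s. greatest M s (Lower M {p, q})" ..
  qed
qed

lemma partial_order_prob_order:
  assumes "P \<subseteq> S_probs S"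
  shows "partial_order (prob_order S P)"
proof
  fix p q
  assume "p \<sqsubseteq>\<^bsub>prob_order S P\<^esub> q" "q \<sqsubseteq>\<^bsub>prob_order S P\<^esub> p"
    and "p \<in> carrier (prob_order S P)" "q \<in> carrier (prob_order S P)"
  \<comment> \<open>Pointwise antisymmetry only gives agreement on \<open>S\<close>; extensionality
    fixes the values elsewhere.\<close>
  then have "p \<in> S \<rightarrow>\<^sub>E {0..1}" "q \<in> S \<rightarrow>\<^sub>E {0..1}" "\<And>s. s \<in> S \<Longrightarrow> p s = q s"
    using assms by (auto simp: prob_order_def prob_le_def S_probs_def intro: antisym)
  then show "p .=\<^bsub>prob_order S P\<^esub> q"
    by (auto simp: prob_order_def intro: PiE_ext)
qed (auto simp: prob_order_def prob_le_def intro: order_trans)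

section \<open>States and the representation by evaluations\<close>

context rlse
begin

text \<open>An element is orthogonal to its complement and their sum is \<one>, so additivity
  applies.\<close>

lemma state_compl:
  assumes "rlse_state R m" "x \<in> carrier R"
  shows "m (compl x) = 1 - m x"
proof -
  have "rlse_orth R x (compl x)"
    using assms by (simp add: rlse_orth_def rlse_order_def compl_compl mult_idem)
  then have "m \<one> = m x + m (compl x)"
    using assms add_compl[of x] unfolding rlse_state_def by (metis compl_closed)
  then show ?thesis
    using assms by (simp add: rlse_state_def)
qed

lemma state_add_orthogonal3:
  assumes "rlse_state R m" "x \<in> carrier R" "y \<in> carrier R" "z \<in> carrier R"
    and "rlse_orth R x y" "rlse_orth R y z" "rlse_orth R x z"
  shows "m (x \<oplus> y \<oplus> z) = m x + m y + m z"
proof -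
  \<comment> \<open>Both \<open>x\<close> and \<open>y\<close> lie below \<open>compl z\<close>,
    hence so does their join, which is \<open>x \<oplus> y\<close>.\<close>
  have "rlse_orth R (x \<oplus> y) z"
    using rlse_join_least[of x y "compl z"] add_orthogonal[of x y] assms(2-)
    by (simp only: rlse_orth_def rlse_order_def gorder.simps compl_closed)
  then have "m (x \<oplus> y \<oplus> z) = m (x \<oplus> y) + m z"
    using assms(1-4) by (simp only: rlse_state_def add_closed)
  then show ?thesis
    using assms(1-5) by (simp only: rlse_state_def)
qed

context
  fixes S :: "('a \<Rightarrow> real) set"
  assumes full: "full_states R S"
begin

lemma state_if_full: "m \<in> S \<Longrightarrow> rlse_state R m"
  using full by (simp add: full_states_def)

text \<open>Fullness in terms of evaluations; it yields both injectivity and the transfer of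
  orthogonality.\<close>

lemma prob_le_eval_prob:
  assumes "x \<in> carrier R" "y \<in> carrier R"
  shows "prob_le S (eval_prob S x) (eval_prob S y) \<longleftrightarrow> x \<sqsubseteq>\<^bsub>rlse_order R\<^esub> y"
  using full assms by (simp add: full_states_def prob_le_def eval_prob_def)

lemma eval_prob_compl:
  assumes "x \<in> carrier R"
  shows "eval_prob S (compl x) = prob_compl S (eval_prob S x)"
  using assms
  by (auto simp: eval_prob_def prob_compl_def state_compl state_if_full intro!: restrict_ext)

lemma prob_orth_eval_prob:
  assumes "x \<in> carrier R" "y \<in> carrier R"
  shows "prob_orth S (eval_prob S x) (eval_prob S y) \<longleftrightarrow> rlse_orth R x y"
  using assms
  by (simp add: prob_orth_def rlse_orth_def compl_closed prob_le_eval_prob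
      flip: eval_prob_compl)

lemma eval_prob_in_S_probs: "eval_prob S ` carrier R \<subseteq> S_probs S"
  using state_if_full by (fastforce simp: S_probs_def eval_prob_def rlse_state_def PiE_iff)

lemma order_isomorphism_eval_prob:
  "order_isomorphism (rlse_order R) (prob_order S (eval_prob S ` carrier R)) (eval_prob S)"
proof -
  let ?P = "eval_prob S ` carrier R"
  have po: "partial_order (prob_order S ?P)"
    by (rule partial_order_prob_order[OF eval_prob_in_S_probs])
  have carrier_rlse_order: "carrier (rlse_order R) = carrier R"
    by (simp add: rlse_order_def)
  have carrier_prob_order: "carrier (prob_order S ?P) = ?P"
    and le_prob_order: "p \<sqsubseteq>\<^bsub>prob_order S ?P\<^esub> q \<longleftrightarrow> prob_le S p q" for p q
    by (simp_all add: prob_order_def)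
  have "inj_on (eval_prob S) (carrier R)"
  proof
    fix x y
    assume xy: "x \<in> carrier R" "y \<in> carrier R" and "eval_prob S x = eval_prob S y"
    \<comment> \<open>Equal evaluations give both inequalities by fullness; commutativity of the
      product then identifies \<open>x\<close> and \<open>y\<close>.\<close>
    then have "x \<sqsubseteq>\<^bsub>rlse_order R\<^esub> y" "y \<sqsubseteq>\<^bsub>rlse_order R\<^esub> x"
      by (simp_all flip: prob_le_eval_prob add: prob_le_def)
    then show "x = y"
      using xy by (simp add: rlse_order_def m_comm)
  qed
  then show ?thesis
    using prob_le_eval_prob
    by (simp add: order_isomorphism_def order_emb_def partial_order_rlse_order po bij_betw_def
        partial_order.axioms(1) carrier_rlse_order carrier_prob_order le_prob_order)
qed

lemma algebra_of_S_probs_eval_prob: "algebra_of_S_probs S (eval_prob S ` carrier R)"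
proof -
  let ?P = "eval_prob S ` carrier R"
  have one: "(\<lambda>s\<in>S. 1) = eval_prob S \<one>"
    using state_if_full by (auto simp: eval_prob_def rlse_state_def intro!: restrict_ext)
  \<comment> \<open>As \<zero> is \<open>compl \<one>\<close>, its evaluation is the pointwise
    complement of the constant 1.\<close>
  have zero: "(\<lambda>s\<in>S. 0) = eval_prob S \<zero>"
    using eval_prob_compl[OF one_closed]
    by (auto simp: compl_one prob_compl_def simp flip: one intro!: restrict_ext)
  \<comment> \<open>The pointwise sum of three pairwise orthogonal evaluations is itself the
    evaluation of \<open>x \<oplus> y \<oplus> z\<close>.\<close>
  have "(\<lambda>s\<in>S. eval_prob S x s + eval_prob S y s + eval_prob S z s) \<in> ?P"
    if xyz: "x \<in> carrier R" "y \<in> carrier R" "z \<in> carrier R"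
      and orth: "rlse_orth R x y" "rlse_orth R y z" "rlse_orth R x z" for x y z
  proof
    show "x \<oplus> y \<oplus> z \<in> carrier R"
      using xyz by (simp add: add_closed)
    show "(\<lambda>s\<in>S. eval_prob S x s + eval_prob S y s + eval_prob S z s) = eval_prob S (x \<oplus> y \<oplus> z)"
      using xyz orth
      by (auto simp: eval_prob_def state_add_orthogonal3 state_if_full intro!: restrict_ext)
  qed
  then show ?thesis
    using eval_prob_in_S_probs
    by (auto simp: algebra_of_S_probs_def one zero zero_closed prob_orth_eval_prob compl_closed
        simp flip: eval_prob_compl)
qed

end

end

theorem theorem2p7:
  fixes R :: "('a, 'b) ring_scheme" (structure)
    and S :: "('a \<Rightarrow> real) set"
  assumes "rlse R"
    and "full_states R S"
  shows "order_isomorphism (rlse_order R) (prob_order S (eval_prob S ` carrier R)) (eval_prob S) \<and>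
    lattice_ordered_algebra_of_S_probs S (eval_prob S ` carrier R)"
  using rlse.order_isomorphism_eval_prob[OF assms] rlse.algebra_of_S_probs_eval_prob[OF assms]
    order_isomorphism_lattice[OF rlse.order_isomorphism_eval_prob[OF assms]
      rlse.lattice_rlse_order[OF assms(1)]]
  by (simp add: lattice_ordered_algebra_of_S_probs_def)

end
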